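(* Let $\sigma>0$ and $\delta\in(0,1)$ be given, let $w_0\equiv 1$ be the trivial weight function, and let $\beta>0$ be fixed, with the exponent $q$ and the truncation threshold $\epsilon\in(0,1)$ related by $\beta=q\ln\epsilon^{-1}$. Put $s=\delta^{-1}$ and $\gamma:=\beta^{-s}\,\Gamma(s+1)$, where $\Gamma(s)=\int_0^\infty t^{s-1}e^{-t}\,dt$. Then for every random matrix $K\in\mathcal{R}_{\sigma,\delta}(\mathbb{Z})$ the sparsity indicator function $\Psi_{K,w_0}(q,\epsilon)$ converges to $\gamma$ in probability as $\epsilon$ tends to zero, i.e. $$\lim_{\epsilon\to 0^+}\mathbb{P}\Big\{\big|\Psi_{K,w_0}(q,\epsilon)-\gamma\big|<\epsilon_0\Big\}=1\quad\text{for every }\epsilon_0>0.$$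
   Context: $\mathcal{R}_{\sigma,\delta}(\mathbb{Z})$ is the class of random matrices $K=\big[r_{ij}\,e^{-(|i-j|/\sigma)^\delta}\big]_{i,j\in\mathbb{Z}}$, where the coefficients $r_{ij}$ are drawn from the continuous uniform distribution $\mathbf{U}(-1,1)$. For a weight $w$ on $\mathbb{Z}\times\mathbb{Z}$ and $q>0$, $$\|K\|_{\mathcal{S}_{q,w}}=\max\Big\{\sup_{i}\Big(\sum_{j}|K_{ij}|^q w(i,j)^q\Big)^{1/q},\ \sup_{j}\Big(\sum_{i}|K_{ij}|^q w(i,j)^q\Big)^{1/q}\Big\}.$$ For $0<\epsilon<1$, the sparsity indicator function is $$\Psi_{K,w}(q,\epsilon)=\frac{\|K\|_{\mathcal{S}_{q,w}}^q}{2\big\lfloor\sigma(\ln\epsilon^{-1})^{1/\delta}\big\rfloor+1},$$ with $\lfloor\cdot\rfloor$ the floor function. *)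

theory Defs
  imports "HOL-Probability.Probability"
begin

text \<open>Real powers of extended nonnegative numbers. The value at \<open>\<infinity>\<close> is the intended one for
  exponents \<open>p > 0\<close>, the only ones used here.\<close>

definition ennreal_powr :: "ennreal \<Rightarrow> real \<Rightarrow> ennreal" where
  "ennreal_powr x p = (if x = \<infinity> then \<infinity> else ennreal (enn2real x powr p))"

text \<open>The norm \<open>\<parallel>K\<parallel>\<close> of the class \<open>S\<^sub>q\<^sub>,\<^sub>w\<close>, for \<open>q > 0\<close> and a nonnegative weight \<open>w\<close>. It takes values in
  \<open>[0, \<infinity>]\<close>, so that sums and suprema have their ordinary meaning when they are infinite.\<close>

definition schur_norm :: "real \<Rightarrow> (int \<Rightarrow> int \<Rightarrow> real) \<Rightarrow> (int \<Rightarrow> int \<Rightarrow> real) \<Rightarrow> ennreal" where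
  "schur_norm q w K =
     max (SUP i. ennreal_powr (\<Sum>\<^sub>\<infinity>j\<in>UNIV. ennreal (\<bar>K i j\<bar> powr q * w i j powr q)) (1 / q))
         (SUP j. ennreal_powr (\<Sum>\<^sub>\<infinity>i\<in>UNIV. ennreal (\<bar>K i j\<bar> powr q * w i j powr q)) (1 / q))"

definition sparsity_indicator ::
  "real \<Rightarrow> real \<Rightarrow> (int \<Rightarrow> int \<Rightarrow> real) \<Rightarrow> (int \<Rightarrow> int \<Rightarrow> real) \<Rightarrow> real \<Rightarrow> real \<Rightarrow> ennreal" where
  "sparsity_indicator \<sigma> \<delta> K w q \<epsilon> =
     ennreal_powr (schur_norm q w K) q
       / ennreal (real_of_int (2 * \<lfloor>\<sigma> * (ln (inverse \<epsilon>)) powr (1 / \<delta>)\<rfloor> + 1))"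

text \<open>The random matrices on the probability space \<open>M\<close> that belong to the class \<open>R\<^sub>\<sigma>\<^sub>,\<^sub>\<delta>\<close> over the
  integers. Only the law of each single coefficient is prescribed: the joint law is arbitrary, so
  independent coefficients are included as a special case.\<close>

definition random_matrices :: "'a measure \<Rightarrow> real \<Rightarrow> real \<Rightarrow> ('a \<Rightarrow> int \<Rightarrow> int \<Rightarrow> real) set" where
  "random_matrices M \<sigma> \<delta> =
     {K. \<exists>r :: int \<Rightarrow> int \<Rightarrow> 'a \<Rightarrow> real.
           (\<forall>i j. distributed M lborel (r i j)
              (\<lambda>x. ennreal (indicator {-1<..<1} x / measure lborel {-1<..<1 :: real}))) \<and>
           (\<forall>\<omega>\<in>space M. \<forall>i j.
              K \<omega> i j = r i j \<omega> * exp (- ((real_of_int \<bar>i - j\<bar> / \<sigma>) powr \<delta>)))}"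

end

(* The q-th power of the norm lies between the sum over row 0 and, almost surely, the full sum
   T = sum over k of exp(-q (|k|/sigma)^delta). The gap between T and the row sum has expectation
   at most q T, because E|r|^q = 1/(q+1); so by Markov's inequality, which needs no independence,
   both bounds agree in probability after division by the denominator N = 2 floor(...) + 1, as
   q -> 0 while T/N stays bounded. Writing each exp(-a) as the integral of exp(-t) over t >= a
   turns T into the integral of exp(-t) times the number of integers k with
   |k| <= sigma (t/q)^(1/delta); that number is 2 sigma (t/q)^(1/delta) up to an error of 1, whence
   |T - 2 sigma q^(-s) Gamma(s+1)| <= 1 and T/N -> gamma. *)

theory Submission
  imports Defs "HOL-Real_Asymp.Real_Asymp"
begin

section \<open>Stretched-exponential sums over the integers and the Gamma function\<close>

text \<open>Both sides are suprema of finite partial sums: the integral along an enumeration of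
  \<open>A\<close>, the sum over all finite subsets. This opens the infinite sums of the definitions
  to Tonelli and to additivity of the integral.\<close>

lemma nn_integral_count_space_eq_infsum:
  fixes f :: "'a \<Rightarrow> ennreal"
  assumes "countable A"
  shows "(\<integral>\<^sup>+x. f x \<partial>count_space A) = infsum f A"
proof (cases "finite A")
  case True
  then show ?thesis by (simp add: nn_integral_count_space_finite)
next
  case False
  let ?g = "from_nat_into A"
  have bij: "bij_betw ?g UNIV A"
    using assms False by (rule bij_betw_from_nat_into)
  have S: "infsum f A = (SUP F\<in>{F. finite F \<and> F \<subseteq> A}. sum f F)"
    by (rule nonneg_infsum_complete) simp
  have "(\<integral>\<^sup>+x. f x \<partial>count_space A) = (\<integral>\<^sup>+n. f (?g n) \<partial>count_space UNIV)"
    using nn_integral_bij_count_space[OF bij] by metis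
  also have "\<dots> = (\<Sum>n. f (?g n))"
    by (rule nn_integral_count_space_nat)
  also have "\<dots> = (SUP n. \<Sum>k<n. f (?g k))"
    by (rule suminf_eq_SUP)
  also have "\<dots> \<le> infsum f A"
  proof (rule SUP_least)
    fix n
    have inj: "inj_on ?g {..<n}"
      using bij by (auto simp: bij_betw_def inj_on_def)
    have "(\<Sum>k<n. f (?g k)) = sum f (?g ` {..<n})"
      using inj by (simp add: sum.reindex)
    also have "\<dots> \<le> infsum f A"
      unfolding S using bij by (intro SUP_upper) (auto simp: bij_betw_def)
    finally show "(\<Sum>k<n. f (?g k)) \<le> infsum f A" .
  qed
  finally have le: "(\<integral>\<^sup>+x. f x \<partial>count_space A) \<le> infsum f A" .
  \<comment> \<open>Each finite partial sum is the integral of \<open>f\<close> cut off to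
    \<open>F\<close>.\<close>
  have "infsum f A \<le> (\<integral>\<^sup>+x. f x \<partial>count_space A)"
    unfolding S
  proof (rule SUP_least, clarify)
    fix F assume F: "finite F" "F \<subseteq> A"
    have "sum f F = (\<integral>\<^sup>+x. f x * indicator F x \<partial>count_space A)"
      using F by (subst nn_integral_count_space'[of F]) (auto intro!: sum.cong)
    also have "\<dots> \<le> (\<integral>\<^sup>+x. f x \<partial>count_space A)"
      by (intro nn_integral_mono) (auto split: split_indicator)
    finally show "sum f F \<le> (\<integral>\<^sup>+x. f x \<partial>count_space A)" .
  qed
  with le show ?thesis by (rule antisym)
qed

lemma nn_integral_exp_minus_atLeast:
  "(\<integral>\<^sup>+t. ennreal (exp (- t)) * indicator {a..} t \<partial>lborel) = ennreal (exp (- a))" for a :: real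
proof -
  have "((\<lambda>t::real. - exp (- t)) \<longlongrightarrow> - 0) at_top"
    by (intro tendsto_minus filterlim_compose[OF exp_at_bot] filterlim_uminus_at_bot_at_top)
  then have "(\<integral>\<^sup>+t. ennreal (exp (- t)) * indicator {a..} t \<partial>lborel) = ennreal (0 - (- exp (- a)))"
    by (intro nn_integral_FTC_atLeast[where F = "\<lambda>t. - exp (- t)"])
      (auto intro!: derivative_eq_intros)
  then show ?thesis by simp
qed

lemma emeasure_count_space_abs_le:
  fixes y :: real
  assumes "0 \<le> y"
  shows "emeasure (count_space UNIV) {k::int. real_of_int \<bar>k\<bar> \<le> y} = ennreal (2 * of_int \<lfloor>y\<rfloor> + 1)"
proof -
  have "{k::int. real_of_int \<bar>k\<bar> \<le> y} = {- \<lfloor>y\<rfloor>..\<lfloor>y\<rfloor>}"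
    by (auto simp: abs_le_iff le_floor_iff) linarith+
  moreover have "0 \<le> \<lfloor>y\<rfloor>" using assms by simp
  ultimately show ?thesis
    by (simp add: ennreal_of_nat_eq_real_of_nat)
qed

text \<open>Each term is the tail integral of exp(-t) starting at its own exponent. Exchanging sum
  and integral leaves, for each t, the number of integers whose exponent is at most t.\<close>

lemma stretched_exp_sum_layer_cake:
  fixes \<sigma> \<delta> q :: real
  assumes "\<sigma> > 0" "\<delta> > 0" "q > 0"
  shows "(\<Sum>\<^sub>\<infinity>k::int. ennreal (exp (- (q * (real_of_int \<bar>k\<bar> / \<sigma>) powr \<delta>)))) =
    (\<integral>\<^sup>+t. ennreal (indicator {0..} t * exp (- t) *
       (2 * of_int \<lfloor>\<sigma> * (t / q) powr (1 / \<delta>)\<rfloor> + 1)) \<partial>lborel)"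
proof -
  let ?a = "\<lambda>k::int. q * (real_of_int \<bar>k\<bar> / \<sigma>) powr \<delta>"
  let ?y = "\<lambda>t. \<sigma> * (t / q) powr (1 / \<delta>)"
  \<comment> \<open>Inverts the increasing map x -> q x^\<delta> on the nonnegative reals; for
    negative t the expression \<open>(t / q) powr (1 / \<delta>)\<close> is not the inverse.\<close>
  have iff: "?a k \<le> t \<longleftrightarrow> real_of_int \<bar>k\<bar> \<le> ?y t" if "0 \<le> t" for k t
  proof -
    let ?x = "real_of_int \<bar>k\<bar> / \<sigma>"
    have "?a k \<le> t \<longleftrightarrow> ?x powr \<delta> \<le> t / q"
      using assms by (simp add: field_simps)
    also have "\<dots> \<longleftrightarrow> ?x powr \<delta> \<le> ((t / q) powr (1 / \<delta>)) powr \<delta>"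
      using assms that by (simp add: powr_powr)
    also have "\<dots> \<longleftrightarrow> ?x \<le> (t / q) powr (1 / \<delta>)"
      using assms powr_less_mono2[of \<delta> "(t / q) powr (1 / \<delta>)" ?x] powr_mono2[of \<delta> ?x "(t / q) powr (1 / \<delta>)"]
      by (cases "?x \<le> (t / q) powr (1 / \<delta>)") auto
    also have "\<dots> \<longleftrightarrow> real_of_int \<bar>k\<bar> \<le> ?y t"
      using assms by (simp add: field_simps)
    finally show ?thesis .
  qed
  have "(\<Sum>\<^sub>\<infinity>k::int. ennreal (exp (- ?a k))) =
      (\<integral>\<^sup>+k. \<integral>\<^sup>+t. ennreal (exp (- t)) * indicator {?a k..} t \<partial>lborel \<partial>count_space UNIV)"
    by (simp add: nn_integral_exp_minus_atLeast nn_integral_count_space_eq_infsum)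
  also have "\<dots> = (\<integral>\<^sup>+t. \<integral>\<^sup>+k. ennreal (exp (- t)) * indicator {?a k..} t \<partial>count_space UNIV \<partial>lborel)"
    by (rule nn_integral_count_space_nn_integral[symmetric]) auto
  also have "\<dots> = (\<integral>\<^sup>+t. ennreal (indicator {0..} t * exp (- t) * (2 * of_int \<lfloor>?y t\<rfloor> + 1)) \<partial>lborel)"
  proof (rule nn_integral_cong)
    fix t :: real
    show "(\<integral>\<^sup>+k. ennreal (exp (- t)) * indicator {?a k..} t \<partial>count_space UNIV) =
        ennreal (indicator {0..} t * exp (- t) * (2 * of_int \<lfloor>?y t\<rfloor> + 1))"
    proof (cases "0 \<le> t")
      case True
      have y: "0 \<le> ?y t" using assms by simp
      have "(\<integral>\<^sup>+k. ennreal (exp (- t)) * indicator {?a k..} t \<partial>count_space UNIV) =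
          (\<integral>\<^sup>+k. ennreal (exp (- t)) * indicator {k. real_of_int \<bar>k\<bar> \<le> ?y t} k \<partial>count_space UNIV)"
        using iff[OF True] by (intro nn_integral_cong) (auto split: split_indicator)
      also have "\<dots> = ennreal (exp (- t)) * ennreal (2 * of_int \<lfloor>?y t\<rfloor> + 1)"
        by (simp add: nn_integral_cmult emeasure_count_space_abs_le[OF y, unfolded of_int_abs])
      finally show ?thesis
        using True y by (simp add: ennreal_mult)
    next
      \<comment> \<open>All exponents are nonnegative, so nothing is counted below 0, in agreement
        with the factor \<open>indicator {0..} t\<close>.\<close>
      case False
      have "\<not> ?a k \<le> t" for k
      proof -
        have "0 \<le> ?a k" using assms by simp
        with False show ?thesis by linarith
      qed
      with False show ?thesis by simp
    qed
  qed
  finally show ?thesis .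
qed

text \<open>The count 2 floor(y) + 1 differs from 2y by at most 1, and exp(-t) has total mass 1 on
  the half-line, so the error is at most 1 uniformly in \<open>q\<close>. With 2y in place of the
  count the integral is exactly \<open>G\<close>. The upper bound also makes the sum finite, which
  yields the real number \<open>T\<close>.\<close>

lemma stretched_exp_sum_bounds:
  fixes \<sigma> \<delta> q :: real
  assumes "\<sigma> > 0" "\<delta> > 0" "q > 0"
  defines "G \<equiv> 2 * \<sigma> * q powr (- (1 / \<delta>)) * Gamma (1 / \<delta> + 1)"
  obtains T where "0 \<le> T" "\<bar>T - G\<bar> \<le> 1"
    "(\<Sum>\<^sub>\<infinity>k::int. ennreal (exp (- (q * (real_of_int \<bar>k\<bar> / \<sigma>) powr \<delta>)))) = ennreal T"
proof -
  let ?s = "1 / \<delta>"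
  let ?y = "\<lambda>t. \<sigma> * (t / q) powr ?s"
  let ?S = "\<Sum>\<^sub>\<infinity>k::int. ennreal (exp (- (q * (real_of_int \<bar>k\<bar> / \<sigma>) powr \<delta>)))"
  let ?c = "2 * \<sigma> * q powr (- ?s)"
  have G0: "0 \<le> G"
    using assms by (auto simp: G_def intro!: mult_nonneg_nonneg add_pos_pos)
  have E: "(\<integral>\<^sup>+t. ennreal (indicator {0..} t * exp (- t)) \<partial>lborel) = ennreal 1"
    using nn_integral_exp_minus_atLeast[of 0]
    by (simp add: ennreal_mult' mult.commute flip: ennreal_indicator)
  \<comment> \<open>Pulling out the power of \<open>q\<close> leaves t^(1/\<delta>), which is the
    power in the Gamma integrand at argument 1/\<delta> + 1.\<close>
  have y: "2 * ?y t = ?c * t powr ?s" if "0 \<le> t" for t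
    using assms that by (simp add: powr_divide powr_minus_divide)
  have "(\<integral>\<^sup>+t. ennreal (indicator {0..} t * exp (- t) * (2 * ?y t)) \<partial>lborel) =
      (\<integral>\<^sup>+t. ennreal ?c * ennreal (indicator {0..} t * t powr (?s + 1 - 1) / exp t) \<partial>lborel)"
  proof (rule nn_integral_cong)
    fix t :: real
    have "indicator {0..} t * exp (- t) * (2 * ?y t) =
        ?c * (indicator {0..} t * t powr (?s + 1 - 1) / exp t)"
      by (cases "0 \<le> t") (simp_all only: y, simp_all add: exp_minus divide_inverse)
    then show "ennreal (indicator {0..} t * exp (- t) * (2 * ?y t)) =
        ennreal ?c * ennreal (indicator {0..} t * t powr (?s + 1 - 1) / exp t)"
      using assms(1) by (simp only: ennreal_mult'[of ?c, symmetric] mult_nonneg_nonneg powr_ge_zero zero_le_numeral less_imp_le)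
  qed
  also have "\<dots> = ennreal ?c * ennreal (Gamma (?s + 1))"
    using assms(2) by (subst Gamma_conv_nn_integral_real) (auto intro!: nn_integral_cmult add_pos_pos)
  also have "\<dots> = ennreal G"
    using assms by (simp add: G_def ennreal_mult')
  finally have I: "(\<integral>\<^sup>+t. ennreal (indicator {0..} t * exp (- t) * (2 * ?y t)) \<partial>lborel) = ennreal G" .
  have "?S \<le> (\<integral>\<^sup>+t. ennreal (indicator {0..} t * exp (- t) * (2 * ?y t)) +
      ennreal (indicator {0..} t * exp (- t)) \<partial>lborel)"
    unfolding stretched_exp_sum_layer_cake[OF assms(1-3)] using assms(1)
    by (intro nn_integral_mono)
      (auto simp: distrib_left simp flip: ennreal_plus split: split_indicator intro!: ennreal_leI)
  also have "\<dots> = ennreal G + ennreal 1"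
    by (subst nn_integral_add) (simp_all only: I E, measurable)
  finally have up: "?S \<le> ennreal (G + 1)"
    using G0 by simp
  have le: "2 * ?y t \<le> 2 * of_int \<lfloor>?y t\<rfloor> + 2" "0 \<le> \<lfloor>?y t\<rfloor>" for t
    using assms(1) by (linarith, simp)
  \<comment> \<open>The error of mass 1 is added to the side of the sum, which avoids truncated
    subtraction in \<open>ennreal\<close>.\<close>
  have "ennreal G \<le> (\<integral>\<^sup>+t. ennreal (indicator {0..} t * exp (- t) * (2 * of_int \<lfloor>?y t\<rfloor> + 1)) +
      ennreal (indicator {0..} t * exp (- t)) \<partial>lborel)"
    unfolding I[symmetric]
  proof (rule nn_integral_mono)
    fix t :: real
    have "indicator {0..} t * exp (- t) * (2 * ?y t) \<le>
        indicator {0..} t * exp (- t) * (2 * of_int \<lfloor>?y t\<rfloor> + 2)"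
      using le(1)[of t] by (intro mult_left_mono) auto
    then show "ennreal (indicator {0..} t * exp (- t) * (2 * ?y t)) \<le>
        ennreal (indicator {0..} t * exp (- t) * (2 * of_int \<lfloor>?y t\<rfloor> + 1)) +
        ennreal (indicator {0..} t * exp (- t))"
      using le(2)[of t] by (subst ennreal_plus[symmetric])
        (auto simp: distrib_left simp del: ennreal_plus split: split_indicator intro!: ennreal_leI add_nonneg_nonneg mult_nonneg_nonneg)
  qed
  also have "\<dots> = ?S + ennreal 1"
    unfolding stretched_exp_sum_layer_cake[OF assms(1-3)]
    by (subst nn_integral_add) (simp_all only: E, measurable)
  finally have lo: "ennreal G \<le> ?S + ennreal 1" .
  obtain T where T: "0 \<le> T" "?S = ennreal T"
    using up by (cases ?S) (auto simp: top_unique)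
  have "T \<le> G + 1"
    using up G0 unfolding T(2) by (simp add: del: ennreal_plus)
  moreover have "G \<le> T + 1"
    using lo T(1) unfolding T(2) by (simp flip: ennreal_plus ennreal_1)
  ultimately show ?thesis
    using that[OF T(1) _ T(2)] by (simp add: abs_le_iff)
qed


section \<open>Bounds and measurability for the q-th power of the norm\<close>

lemma ennreal_powr_mono: "ennreal_powr x p \<le> ennreal_powr y p" if "x \<le> y" "0 \<le> p"
  using that by (auto simp: ennreal_powr_def top_unique less_top intro!: ennreal_leI powr_mono2 enn2real_mono)

lemma ennreal_powr_inverse_cancel: "ennreal_powr (ennreal_powr x (1 / q)) q = x" if "0 < q"
  using that by (auto simp: ennreal_powr_def powr_powr less_top ennreal_enn2real_if)

lemma measurable_ennreal_powr [measurable (raw)]: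
  assumes [measurable]: "f \<in> borel_measurable M"
  shows "(\<lambda>x. ennreal_powr (f x) p) \<in> borel_measurable M"
  unfolding ennreal_powr_def infinity_ennreal_def by measurable

text \<open>Taking the q-th power undoes the exponent 1/q, at infinity as well, so any single row
  bounds the norm from below.\<close>

lemma row_sum_le_schur_norm_powr:
  assumes "0 < q"
  shows "(\<Sum>\<^sub>\<infinity>j. ennreal (\<bar>K i j\<bar> powr q * w i j powr q)) \<le> ennreal_powr (schur_norm q w K) q"
proof -
  let ?R = "\<lambda>i. \<Sum>\<^sub>\<infinity>j. ennreal (\<bar>K i j\<bar> powr q * w i j powr q)"
  have "ennreal_powr (?R i) (1 / q) \<le> (SUP i. ennreal_powr (?R i) (1 / q))"
    by (rule SUP_upper) simp
  also have "\<dots> \<le> schur_norm q w K"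
    unfolding schur_norm_def by (rule max.cobounded1)
  finally have "ennreal_powr (ennreal_powr (?R i) (1 / q)) q \<le> ennreal_powr (schur_norm q w K) q"
    using assms by (intro ennreal_powr_mono) auto
  then show ?thesis
    using assms by (simp add: ennreal_powr_inverse_cancel)
qed

lemma schur_norm_powr_le:
  assumes "0 < q"
    and "\<And>i. (\<Sum>\<^sub>\<infinity>j. ennreal (\<bar>K i j\<bar> powr q * w i j powr q)) \<le> B"
    and "\<And>j. (\<Sum>\<^sub>\<infinity>i. ennreal (\<bar>K i j\<bar> powr q * w i j powr q)) \<le> B"
  shows "ennreal_powr (schur_norm q w K) q \<le> B"
proof -
  have "schur_norm q w K \<le> ennreal_powr B (1 / q)"
    unfolding schur_norm_def using assms
    by (intro max.boundedI SUP_least ennreal_powr_mono) auto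
  then have "ennreal_powr (schur_norm q w K) q \<le> ennreal_powr (ennreal_powr B (1 / q)) q"
    using assms by (intro ennreal_powr_mono) auto
  then show ?thesis
    using assms by (simp add: ennreal_powr_inverse_cancel)
qed

text \<open>The sum is a supremum over finite index sets, and a countable type has only countably
  many of these.\<close>

lemma borel_measurable_infsum_ennreal [measurable (raw)]:
  fixes f :: "'b \<Rightarrow> 'c::countable \<Rightarrow> ennreal"
  assumes [measurable]: "\<And>j. (\<lambda>x. f x j) \<in> borel_measurable M"
  shows "(\<lambda>x. \<Sum>\<^sub>\<infinity>j. f x j) \<in> borel_measurable M"
proof -
  have "(\<lambda>x. \<Sum>\<^sub>\<infinity>j. f x j) = (\<lambda>x. SUP F\<in>{F::'c set. finite F}. \<Sum>j\<in>F. f x j)"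
    by (rule ext, subst nonneg_infsum_complete) auto
  also have "\<dots> \<in> borel_measurable M"
    by (intro borel_measurable_SUP countable_Collect_finite) measurable
  finally show ?thesis .
qed

lemma measurable_sparsity_indicator:
  assumes [measurable]: "\<And>i j. (\<lambda>\<omega>. K \<omega> i j) \<in> borel_measurable M"
  shows "(\<lambda>\<omega>. sparsity_indicator \<sigma> \<delta> (K \<omega>) w q \<epsilon>) \<in> borel_measurable M"
  unfolding sparsity_indicator_def schur_norm_def
  by measurable

section \<open>Moments of a single uniform coefficient\<close>

lemma has_integral_abs_powr:
  fixes q :: real
  assumes "0 < q"
  shows "((\<lambda>x. \<bar>x\<bar> powr q) has_integral 2 / (q + 1)) {-1..1}"
proof -
  have "((\<lambda>x. x powr q) has_integral 1 / (q + 1)) {0..1}"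
    using has_integral_powr_from_0[of q 1] assms by simp
  then have pos: "((\<lambda>x. \<bar>x\<bar> powr q) has_integral 1 / (q + 1)) {0..1}"
    by (rule has_integral_eq[rotated]) simp
  then have "((\<lambda>x. \<bar>- x\<bar> powr q) has_integral 1 / (q + 1)) {-1..-0}"
    by (subst has_integral_reflect_real)
  then have neg: "((\<lambda>x. \<bar>x\<bar> powr q) has_integral 1 / (q + 1)) {-1..0}"
    by simp
  from has_integral_combine[OF _ _ neg pos] show ?thesis by simp
qed

abbreviation uniform_unit_density :: "real \<Rightarrow> ennreal" where
  "uniform_unit_density \<equiv> (\<lambda>x. ennreal (indicator {-1<..<1} x / measure lborel {-1<..<1 :: real}))"

text \<open>The density vanishes outside the open interval. The law alone gives the bound only
  almost surely.\<close>

lemma uniform_AE_abs_less: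
  assumes D: "distributed M lborel X uniform_unit_density"
  shows "AE \<omega> in M. \<bar>X \<omega>\<bar> < 1"
proof -
  have [measurable]: "X \<in> borel_measurable M"
    using distributed_measurable[OF D] by simp
  have "(\<integral>\<^sup>+\<omega>. indicator {x. 1 \<le> \<bar>x\<bar>} (X \<omega>) \<partial>M) =
      (\<integral>\<^sup>+x. uniform_unit_density x * indicator {x. 1 \<le> \<bar>x\<bar>} x \<partial>lborel)"
    by (rule distributed_nn_integral[OF D, symmetric]) measurable
  also have "\<dots> = (\<integral>\<^sup>+(x::real). 0 \<partial>lborel)"
    by (intro nn_integral_cong) (auto split: split_indicator)
  finally have "(\<integral>\<^sup>+\<omega>. indicator {x. 1 \<le> \<bar>x\<bar>} (X \<omega>) \<partial>M) = 0" by simp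
  then have "AE \<omega> in M. indicator {x. 1 \<le> \<bar>x\<bar>} (X \<omega>) = (0::ennreal)"
    by (subst (asm) nn_integral_0_iff_AE) simp_all
  then show ?thesis
    by eventually_elim (auto simp: indicator_eq_0_iff)
qed

text \<open>The expectation is 1 - 1/(q+1) = q/(q+1). Its decay as q -> 0 is what makes the random
  fluctuation vanish. Where \<bar>X\<bar> exceeds 1, \<open>ennreal\<close> clips the defect to 0,
  but this happens with probability 0.\<close>

lemma uniform_expectation_defect_le:
  assumes D: "distributed M lborel X uniform_unit_density" and q: "0 < q"
  shows "(\<integral>\<^sup>+\<omega>. ennreal (1 - \<bar>X \<omega>\<bar> powr q) \<partial>M) \<le> ennreal q"
proof -
  have le1: "\<bar>x\<bar> powr q \<le> 1" if "x \<in> {-1..1}" for x :: real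
    using that q powr_mono2[of q "\<bar>x\<bar>" 1] by auto
  have "(\<integral>\<^sup>+\<omega>. ennreal (1 - \<bar>X \<omega>\<bar> powr q) \<partial>M) =
      (\<integral>\<^sup>+x. uniform_unit_density x * ennreal (1 - \<bar>x\<bar> powr q) \<partial>lborel)"
    by (rule distributed_nn_integral[OF D, symmetric]) measurable
  also have "\<dots> \<le> (\<integral>\<^sup>+x. ennreal (indicator {-1..1} x * ((1 - \<bar>x\<bar> powr q) / 2)) \<partial>lborel)"
    by (intro nn_integral_mono)
      (auto split: split_indicator simp: le1 simp flip: ennreal_mult' intro!: ennreal_leI)
  also have "\<dots> = ennreal ((2 - 2 / (q + 1)) / 2)"
  proof (rule nn_integral_has_integral_lebesgue)
    have "((\<lambda>x::real. 1 - \<bar>x\<bar> powr q) has_integral 2 - 2 / (q + 1)) {-1..1}"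
      using has_integral_const_real[of "1::real" "-1" 1]
      by (intro has_integral_diff has_integral_abs_powr q) simp
    then show "((\<lambda>x::real. (1 - \<bar>x\<bar> powr q) / 2) has_integral (2 - 2 / (q + 1)) / 2) {-1..1}"
      by (intro has_integral_divide) simp
  qed (use le1 in auto)
  also have "\<dots> \<le> ennreal q"
    using q by (intro ennreal_leI) (simp add: field_simps)
  finally show ?thesis .
qed

section \<open>Concentration at a fixed threshold\<close>

text \<open>The tolerance \<open>e\<close> is halved: one half absorbs the deterministic bias of
  T/N, the other the random gap between \<open>T\<close> and row 0. Markov's inequality on that gap,
  of mean at most q T, gives the failure probability 2 q (T/N) / e.\<close>

lemma sparsity_indicator_concentration:
  fixes M :: "'a measure" and K :: "'a \<Rightarrow> int \<Rightarrow> int \<Rightarrow> real" and \<sigma> \<delta> q \<epsilon> T N \<gamma> e :: real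
  assumes "prob_space M" "\<sigma> > 0" "\<delta> > 0" "q > 0" "0 < N" "0 < e"
    and K: "K \<in> random_matrices M \<sigma> \<delta>"
    and N: "N = real_of_int (2 * \<lfloor>\<sigma> * (ln (inverse \<epsilon>)) powr (1 / \<delta>)\<rfloor> + 1)"
    and T: "(\<Sum>\<^sub>\<infinity>k::int. ennreal (exp (- (q * (real_of_int \<bar>k\<bar> / \<sigma>) powr \<delta>)))) = ennreal T" "0 \<le> T"
    and near: "\<bar>T / N - \<gamma>\<bar> < e / 2"
  shows "1 - 2 * q * (T / N) / e \<le>
    measure M {\<omega> \<in> space M.
      \<bar>enn2ereal (sparsity_indicator \<sigma> \<delta> (K \<omega>) (\<lambda>i j. 1) q \<epsilon>) - ereal \<gamma>\<bar> < ereal e}"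
proof -
  interpret prob_space M by fact
  obtain r where D: "\<And>i j. distributed M lborel (r i j) uniform_unit_density"
    and Kr: "\<And>\<omega> i j. \<omega> \<in> space M \<Longrightarrow>
        K \<omega> i j = r i j \<omega> * exp (- ((real_of_int \<bar>i - j\<bar> / \<sigma>) powr \<delta>))"
    using K unfolding random_matrices_def by blast
  have [measurable]: "r i j \<in> borel_measurable M" for i j
    using distributed_measurable[OF D] by simp
  have Km: "(\<lambda>\<omega>. K \<omega> i j) \<in> borel_measurable M" for i j
    by (subst measurable_cong[OF Kr]) measurable
  let ?S = "\<lambda>\<omega>. sparsity_indicator \<sigma> \<delta> (K \<omega>) (\<lambda>i j. 1) q \<epsilon>"
  let ?G = "{\<omega> \<in> space M. \<bar>enn2ereal (?S \<omega>) - ereal \<gamma>\<bar> < ereal e}"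
  have Sm [measurable]: "?S \<in> borel_measurable M"
    by (rule measurable_sparsity_indicator) (rule Km)
  have Gm: "?G \<in> sets M" by measurable
  define E where "E k = exp (- (q * (real_of_int \<bar>k\<bar> / \<sigma>) powr \<delta>))" for k :: int
  have E0: "0 \<le> E k" for k by (simp add: E_def)
  \<comment> \<open>Translations and reflections permute the integers, so every row and every column
    of the deterministic envelope has the same total \<open>T\<close>.\<close>
  have sumE: "(\<Sum>\<^sub>\<infinity>k. ennreal (E (i - k))) = ennreal T" "(\<Sum>\<^sub>\<infinity>k. ennreal (E (k - i))) = ennreal T" for i
  proof -
    have "bij (\<lambda>k. i - k)" "bij (\<lambda>k. k - i)"
      by (rule bij_betwI[where g = "\<lambda>k. i - k"], auto, rule bij_betwI[where g = "\<lambda>k. k + i"], auto)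
    then show "(\<Sum>\<^sub>\<infinity>k. ennreal (E (i - k))) = ennreal T" "(\<Sum>\<^sub>\<infinity>k. ennreal (E (k - i))) = ennreal T"
      using infsum_reindex_bij_betw[of _ UNIV UNIV "\<lambda>k. ennreal (E k)"] T(1) unfolding E_def by metis+
  qed
  have entry: "\<bar>K \<omega> i j\<bar> powr q * 1 powr q = \<bar>r i j \<omega>\<bar> powr q * E (i - j)" if "\<omega> \<in> space M" for \<omega> i j
    using that by (simp add: Kr E_def abs_mult powr_mult exp_powr_real mult.commute)
  \<comment> \<open>The gap between \<open>T\<close> and the sum over row 0, written termwise as a
    nonnegative integral so that its expectation can be taken by Tonelli.\<close>
  define Y where "Y \<omega> = (\<integral>\<^sup>+j. ennreal (1 - \<bar>r 0 j \<omega>\<bar> powr q) * ennreal (E (0 - j)) \<partial>count_space UNIV)" for \<omega>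
  have Ym [measurable]: "Y \<in> borel_measurable M"
    unfolding Y_def by (simp add: nn_integral_count_space_eq_infsum)
  have "(\<integral>\<^sup>+\<omega>. Y \<omega> \<partial>M) =
      (\<integral>\<^sup>+j. \<integral>\<^sup>+\<omega>. ennreal (1 - \<bar>r 0 j \<omega>\<bar> powr q) * ennreal (E (0 - j)) \<partial>M \<partial>count_space UNIV)"
    unfolding Y_def by (rule nn_integral_count_space_nn_integral) auto
  also have "\<dots> \<le> (\<integral>\<^sup>+j. ennreal q * ennreal (E (0 - j)) \<partial>count_space UNIV)"
    by (intro nn_integral_mono)
      (auto simp: nn_integral_multc intro!: mult_right_mono uniform_expectation_defect_le[OF D] assms)
  also have "\<dots> = ennreal (q * T)"
    using assms by (simp add: nn_integral_cmult nn_integral_count_space_eq_infsum sumE(1)[of 0, simplified] ennreal_mult)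
  finally have EY: "(\<integral>\<^sup>+\<omega>. Y \<omega> \<partial>M) \<le> ennreal (q * T)" .

  \<comment> \<open>Scaled so that c Y >= 1 says precisely Y/N >= e/2; thus \<open>B\<close> is the
    event that the gap exceeds its share of the tolerance.\<close>
  define c where "c = 2 / (N * e)"
  have c: "0 < c" using assms by (simp add: c_def)
  define B where "B = {\<omega> \<in> space M. 1 \<le> ennreal c * Y \<omega>}"
  have Bm [measurable]: "B \<in> sets M" unfolding B_def by measurable
  have "emeasure M B \<le> ennreal c * (\<integral>\<^sup>+\<omega>. Y \<omega> * indicator (space M) \<omega> \<partial>M)"
    unfolding B_def by (rule nn_integral_Markov_inequality) auto
  also have "\<dots> = ennreal c * (\<integral>\<^sup>+\<omega>. Y \<omega> \<partial>M)"
    by (intro arg_cong2[where f = "(*)"] nn_integral_cong) auto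
  also have "\<dots> \<le> ennreal c * ennreal (q * T)"
    using EY by (intro mult_left_mono) auto
  also have "\<dots> = ennreal (2 * q * (T / N) / e)"
    using c assms by (simp add: c_def field_simps flip: ennreal_mult)
  finally have PB: "prob B \<le> 2 * q * (T / N) / e"
    using assms by (simp add: emeasure_eq_measure)

  \<comment> \<open>There are countably many index pairs, so the almost sure bounds hold
    simultaneously.\<close>
  have "AE \<omega> in M. \<forall>i j. \<bar>r i j \<omega>\<bar> < 1"
    using uniform_AE_abs_less[OF D] by (simp add: AE_all_countable)
  then have "AE \<omega> in M. \<omega> \<in> space M - B \<longrightarrow> \<omega> \<in> ?G"
  proof (rule AE_mp, intro AE_I2 impI)
    fix \<omega> assume \<omega>: "\<omega> \<in> space M" and r1: "\<forall>i j. \<bar>r i j \<omega>\<bar> < 1" and nB: "\<omega> \<in> space M - B"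
    have R1: "\<bar>r i j \<omega>\<bar> powr q \<le> 1" for i j
      using r1 assms(4) by (intro powr_le1) (auto simp: less_imp_le)
    define Z where "Z = ennreal_powr (schur_norm q (\<lambda>i j. 1) (K \<omega>)) q"
    define X where "X = (\<Sum>\<^sub>\<infinity>j. ennreal (\<bar>K \<omega> 0 j\<bar> powr q * 1 powr q))"
    have XZ: "X \<le> Z"
      unfolding X_def Z_def using assms(4) by (rule row_sum_le_schur_norm_powr)
    have le: "ennreal (\<bar>K \<omega> i j\<bar> powr q * 1 powr q) \<le> ennreal (E (i - j))" for i j
      unfolding entry[OF \<omega>] using mult_right_mono[OF R1[of i j] E0[of "i - j"]]
      by (intro ennreal_leI) simp
    have ZT: "Z \<le> ennreal T"
      unfolding Z_def
    proof (rule schur_norm_powr_le)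
      show "(\<Sum>\<^sub>\<infinity>j. ennreal (\<bar>K \<omega> i j\<bar> powr q * 1 powr q)) \<le> ennreal T" for i
        unfolding sumE(1)[of i, symmetric] by (intro infsum_mono le nonneg_summable_on_complete) auto
      show "(\<Sum>\<^sub>\<infinity>i. ennreal (\<bar>K \<omega> i j\<bar> powr q * 1 powr q)) \<le> ennreal T" for j
        unfolding sumE(2)[of j, symmetric] by (intro infsum_mono le nonneg_summable_on_complete) auto
    qed (rule assms)
    \<comment> \<open>Since the coefficients are at most 1 in absolute value here, no clipping
      occurs and \<bar>r\<bar>^q E + (1 - \<bar>r\<bar>^q) E = E term by term.\<close>
    have XY: "X + Y \<omega> = ennreal T"
    proof -
      have "X + Y \<omega> = (\<integral>\<^sup>+j. ennreal (\<bar>K \<omega> 0 j\<bar> powr q * 1 powr q) +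
          ennreal (1 - \<bar>r 0 j \<omega>\<bar> powr q) * ennreal (E (0 - j)) \<partial>count_space UNIV)"
        unfolding X_def Y_def by (subst nn_integral_add) (auto simp: nn_integral_count_space_eq_infsum)
      also have "\<dots> = (\<integral>\<^sup>+j. ennreal (E (0 - j)) \<partial>count_space UNIV)"
        unfolding entry[OF \<omega>] using R1 E0
        by (intro nn_integral_cong, subst ennreal_mult[symmetric])
          (auto simp: left_diff_distrib mult_left_le_one_le simp flip: ennreal_plus)
      also have "\<dots> = ennreal T"
        using sumE(1)[of 0] by (simp add: nn_integral_count_space_eq_infsum)
      finally show ?thesis .
    qed
    \<comment> \<open>All three quantities are bounded by the finite \<open>T\<close>, so the
      remaining argument can be carried out in the reals.\<close>
    obtain z where z: "Z = ennreal z" "0 \<le> z"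
      using ZT by (cases Z) (auto simp: top_unique)
    obtain x where x: "X = ennreal x" "0 \<le> x"
      using XZ z by (cases X) (auto simp: top_unique)
    obtain y where y: "Y \<omega> = ennreal y" "0 \<le> y"
      using XY by (cases "Y \<omega>") auto
    have "x \<le> z" "z \<le> T" "x + y = T"
      using XZ ZT XY x y z T(2) by (simp_all flip: ennreal_plus)
    moreover have "c * y < 1"
      using nB \<omega> y c by (auto simp: B_def not_le simp flip: ennreal_mult ennreal_1)
    then have "y / N < e / 2"
      using assms(5,6) by (simp add: c_def field_simps)
    ultimately have "z / N \<le> T / N" "T / N - e / 2 < z / N"
    proof -
      show "z / N \<le> T / N" using \<open>z \<le> T\<close> assms(5) by (simp add: divide_right_mono)
      have "T / N - y / N \<le> z / N"
        using \<open>x \<le> z\<close> \<open>x + y = T\<close> assms(5) by (simp add: divide_right_mono flip: diff_divide_distrib)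
      with \<open>y / N < e / 2\<close> show "T / N - e / 2 < z / N" by linarith
    qed
    then have "\<bar>z / N - \<gamma>\<bar> < e" using near by linarith
    moreover have "?S \<omega> = ennreal (z / N)"
      using z assms(5) unfolding sparsity_indicator_def Z_def[symmetric] N[symmetric]
      by (simp add: divide_ennreal)
    ultimately show "\<omega> \<in> ?G"
      using \<omega> z assms(5) by simp
  qed
  then have "prob (space M - B) \<le> prob ?G"
    by (rule finite_measure_mono_AE) (rule Gm)
  with PB show ?thesis
    by (simp add: prob_compl[OF Bm])
qed

section \<open>Passage to the limit\<close>

theorem theorem11p1:
  fixes M :: "'a measure" and K :: "'a \<Rightarrow> int \<Rightarrow> int \<Rightarrow> real"
    and \<sigma> \<delta> \<beta> s \<gamma> :: real and q :: "real \<Rightarrow> real" and w\<^sub>0 :: "int \<Rightarrow> int \<Rightarrow> real"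
  assumes "prob_space M"
    and "\<sigma> > 0" and "0 < \<delta>" and "\<delta> < 1" and "\<beta> > 0"
    and "w\<^sub>0 = (\<lambda>i j. 1)"
    and "\<And>\<epsilon>. 0 < \<epsilon> \<Longrightarrow> \<epsilon> < 1 \<Longrightarrow> \<beta> = q \<epsilon> * ln (inverse \<epsilon>)"
    and "s = inverse \<delta>"
    and "\<gamma> = \<beta> powr (- s) * Gamma (s + 1)"
    and "K \<in> random_matrices M \<sigma> \<delta>"
  shows "\<forall>\<epsilon>\<^sub>0 > 0.
    ((\<lambda>\<epsilon>. measure M {\<omega> \<in> space M.
        \<bar>enn2ereal (sparsity_indicator \<sigma> \<delta> (K \<omega>) w\<^sub>0 (q \<epsilon>) \<epsilon>) - ereal \<gamma>\<bar> < ereal \<epsilon>\<^sub>0})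
      \<longlongrightarrow> 1) (at_right 0)"
proof (intro allI impI)
  fix e :: real assume e: "0 < e"
  interpret prob_space M by fact
  let ?P = "\<lambda>\<epsilon>. measure M {\<omega> \<in> space M.
      \<bar>enn2ereal (sparsity_indicator \<sigma> \<delta> (K \<omega>) w\<^sub>0 (q \<epsilon>) \<epsilon>) - ereal \<gamma>\<bar> < ereal e}"
  have s: "s = 1 / \<delta>" "0 < s" using assms by (auto simp: inverse_eq_divide)
  have \<gamma>0: "0 \<le> \<gamma>"
    unfolding assms(9) using s(2) by (intro mult_nonneg_nonneg Gamma_real_nonneg) auto
  define L where "L \<epsilon> = ln (inverse \<epsilon>)" for \<epsilon> :: real
  define N where "N \<epsilon> = real_of_int (2 * \<lfloor>\<sigma> * L \<epsilon> powr (1 / \<delta>)\<rfloor> + 1)" for \<epsilon>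
  have L: "filterlim L at_top (at_right 0)"
    unfolding L_def by (intro filterlim_compose[OF ln_at_top] filterlim_inverse_at_top_right)
  have Lpos: "0 < L \<epsilon>" if "0 < \<epsilon>" "\<epsilon> < 1" for \<epsilon>
    using that unfolding L_def by (intro ln_gt_zero) (simp add: one_less_inverse)
  \<comment> \<open>Since \<open>L\<close> tends to infinity, this forces the exponent to tend to
    0.\<close>
  have q: "q \<epsilon> = \<beta> / L \<epsilon>" if "0 < \<epsilon>" "\<epsilon> < 1" for \<epsilon>
    using assms(7)[OF that] Lpos[OF that] by (simp add: L_def field_simps)
  have N1: "1 \<le> N \<epsilon>" for \<epsilon>
    using assms(2) by (simp add: N_def)
  have ev01: "\<forall>\<^sub>F \<epsilon> in at_right (0::real). 0 < \<epsilon> \<and> \<epsilon> < 1"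
    by (auto simp: eventually_at_right_field intro!: exI[of _ 1])
  \<comment> \<open>The same off-by-one estimate as for the counting function: 2 floor(x) + 1 is
    within 1 of 2x.\<close>
  have Nb: "\<bar>N \<epsilon> - 2 * \<sigma> * L \<epsilon> powr s\<bar> \<le> 1" for \<epsilon>
    unfolding N_def s by (simp add: abs_le_iff) linarith
  have Nlim: "filterlim N at_top (at_right 0)"
  proof (rule filterlim_at_top_mono)
    have "filterlim (\<lambda>x. -1 + 2 * \<sigma> * x powr s) at_top at_top"
      using s(2) assms(2) by real_asymp
    then show "filterlim (\<lambda>\<epsilon>. -1 + 2 * \<sigma> * L \<epsilon> powr s) at_top (at_right 0)"
      using L by (rule filterlim_compose)
    show "\<forall>\<^sub>F \<epsilon> in at_right 0. -1 + 2 * \<sigma> * L \<epsilon> powr s \<le> N \<epsilon>"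
      using Nb by (intro always_eventually allI) (smt (verit))
  qed
  \<comment> \<open>With u = 2 \<sigma> L^s, \<open>T\<close> is within 1 of u \<gamma> and
    \<open>N\<close> is within 1 of u. Hence T and N \<gamma> differ by at most 1 + \<gamma>, and
    dividing by \<open>N\<close> gives the rate.\<close>
  have Tex: "\<exists>T. 0 \<le> T \<and> \<bar>T / N \<epsilon> - \<gamma>\<bar> \<le> (1 + \<gamma>) / N \<epsilon> \<and>
      (\<Sum>\<^sub>\<infinity>k::int. ennreal (exp (- (q \<epsilon> * (real_of_int \<bar>k\<bar> / \<sigma>) powr \<delta>)))) = ennreal T"
    if \<epsilon>: "0 < \<epsilon>" "\<epsilon> < 1" for \<epsilon>
  proof -
    let ?u = "2 * \<sigma> * L \<epsilon> powr s"
    have q0: "0 < q \<epsilon>" using q[OF \<epsilon>] Lpos[OF \<epsilon>] assms by simp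
    \<comment> \<open>Substituting q = \<beta>/L splits q^(-s) into \<beta>^(-s) L^s; the first
      factor joins the Gamma value to form \<gamma>.\<close>
    have G: "2 * \<sigma> * q \<epsilon> powr (- (1 / \<delta>)) * Gamma (1 / \<delta> + 1) = ?u * \<gamma>"
      unfolding q[OF \<epsilon>] assms(9) using Lpos[OF \<epsilon>] assms(5)
      by (simp add: s(1) powr_divide powr_minus_divide)
    obtain T where T: "0 \<le> T" "\<bar>T - ?u * \<gamma>\<bar> \<le> 1"
      "(\<Sum>\<^sub>\<infinity>k::int. ennreal (exp (- (q \<epsilon> * (real_of_int \<bar>k\<bar> / \<sigma>) powr \<delta>)))) = ennreal T"
      using stretched_exp_sum_bounds[OF assms(2,3) q0] unfolding G by blast
    have "\<bar>N \<epsilon> * \<gamma> - ?u * \<gamma>\<bar> \<le> \<gamma>"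
      using mult_right_mono[OF Nb[of \<epsilon>] \<gamma>0] \<gamma>0 by (simp add: abs_mult flip: left_diff_distrib)
    with T(2) have "\<bar>T - N \<epsilon> * \<gamma>\<bar> \<le> 1 + \<gamma>" by linarith
    moreover have "T / N \<epsilon> - \<gamma> = (T - N \<epsilon> * \<gamma>) / N \<epsilon>"
      using N1[of \<epsilon>] by (simp add: field_simps)
    ultimately have "\<bar>T / N \<epsilon> - \<gamma>\<bar> \<le> (1 + \<gamma>) / N \<epsilon>"
      using N1[of \<epsilon>] by (simp add: divide_right_mono)
    with T show ?thesis by blast
  qed
  have small: "((\<lambda>\<epsilon>. (1 + \<gamma>) / N \<epsilon>) \<longlongrightarrow> 0) (at_right 0)"
    by (rule real_tendsto_divide_at_top[OF tendsto_const Nlim])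
  \<comment> \<open>This is the concentration bound with T/N replaced by its upper estimate \<gamma>
    + (1 + \<gamma>)/N. That estimate stays bounded while the factor \<beta>/L tends to 0.\<close>
  have "((\<lambda>\<epsilon>. 1 - 2 * (\<beta> / L \<epsilon>) * (\<gamma> + (1 + \<gamma>) / N \<epsilon>) / e) \<longlongrightarrow> 1 - 2 * 0 * (\<gamma> + 0) / e) (at_right 0)"
    using e by (intro tendsto_intros small real_tendsto_divide_at_top[OF tendsto_const L]) auto
  then have lower: "((\<lambda>\<epsilon>. 1 - 2 * (\<beta> / L \<epsilon>) * (\<gamma> + (1 + \<gamma>) / N \<epsilon>) / e) \<longlongrightarrow> 1) (at_right 0)"
    by simp
  \<comment> \<open>Eventually the bias fits into the half of the tolerance reserved for it.\<close>
  have "\<forall>\<^sub>F \<epsilon> in at_right 0. (1 + \<gamma>) / N \<epsilon> < e / 2"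
    using e by (intro order_tendstoD(2)[OF small]) auto
  with ev01 have "\<forall>\<^sub>F \<epsilon> in at_right 0. 1 - 2 * (\<beta> / L \<epsilon>) * (\<gamma> + (1 + \<gamma>) / N \<epsilon>) / e \<le> ?P \<epsilon>"
  proof eventually_elim
    case (elim \<epsilon>)
    then have \<epsilon>: "0 < \<epsilon>" "\<epsilon> < 1" by auto
    obtain T where T: "0 \<le> T" "\<bar>T / N \<epsilon> - \<gamma>\<bar> \<le> (1 + \<gamma>) / N \<epsilon>"
      "(\<Sum>\<^sub>\<infinity>k::int. ennreal (exp (- (q \<epsilon> * (real_of_int \<bar>k\<bar> / \<sigma>) powr \<delta>)))) = ennreal T"
      using Tex[OF \<epsilon>] by blast
    have q0: "0 < q \<epsilon>" using q[OF \<epsilon>] Lpos[OF \<epsilon>] assms by simp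
    have "1 - 2 * q \<epsilon> * (T / N \<epsilon>) / e \<le> ?P \<epsilon>"
      unfolding assms(6)
    proof (rule sparsity_indicator_concentration[OF assms(1-3) q0 _ e assms(10) _ T(3,1)])
      show "0 < N \<epsilon>" using N1[of \<epsilon>] by linarith
      show "\<bar>T / N \<epsilon> - \<gamma>\<bar> < e / 2" using T(2) elim by linarith
    qed (simp add: N_def L_def)
    moreover have "2 * q \<epsilon> * (T / N \<epsilon>) / e \<le> 2 * q \<epsilon> * (\<gamma> + (1 + \<gamma>) / N \<epsilon>) / e"
      using T(2) q0 e by (intro divide_right_mono mult_left_mono) auto
    ultimately show ?case by (simp add: q[OF \<epsilon>])
  qed
  \<comment> \<open>Squeezed between the lower bound and the constant 1, which bounds every
    probability.\<close>
  then show "(?P \<longlongrightarrow> 1) (at_right 0)"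
    by (rule tendsto_sandwich[OF _ _ lower tendsto_const]) (simp add: always_eventually)
qed

end
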